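(* Let $\alpha$ be real, $x_0=\sqrt2\,\alpha$, $c_1,c_2\in\mathbb C$, $\Lambda=|c_1|^2+|c_2|^2+2\,\mathrm{Re}[c_1c_2^*]\,e^{-2\alpha^2}$, and let $|\chi\rangle=(c_1|\alpha\rangle+c_2|{-\alpha}\rangle)/\sqrt\Lambda$ be the normalized superposition of the coherent states $|\pm\alpha\rangle$, with Wigner function $$W_\chi(x,p)=\frac1{\pi\Lambda}\Big[|c_1|^2e^{-(x-x_0)^2-p^2}+|c_2|^2e^{-(x+x_0)^2-p^2}+2|c_1c_2|\,e^{-x^2-p^2}\cos(2x_0p-\varphi)\Big],\qquad \varphi=\arg(c_1c_2^* ).$$ Assume first that $c_1,c_2\neq0$ and write $\xi(p)=\cos(2x_0p-\varphi)$ and $$B(x,p)=|c_1|^2e^{-(x-x_0)^2}+|c_2|^2e^{-(x+x_0)^2}+2|c_1c_2|\,\xi(p)\,e^{-x^2},$$ so that $W_\chi(x,p)=e^{-p^2}B(x,p)/(\pi\Lambda)$. Then $$\int dx\,|B(x,p)|=\begin{cases}\sqrt\pi\big[|c_1|^2+|c_2|^2+2|c_1c_2|\xi(p)\big],&\xi(p)>-e^{-x_0^2},\\[4pt]\sqrt\pi\big[|c_1|^2+|c_2|^2+2|c_1c_2|\xi(p)\big]-2J(p),&\xi(p)\le-e^{-x_0^2},\end{cases}$$ where, when real roots exist (i.e. when the equation $B(x,p)=0$ has real solutions $x$), $$x_\mp(p)=\frac1{2x_0}\ln\left[\sqrt{\frac{|c_2|^2}{|c_1|^2}}\Big(-\xi(p)e^{x_0^2}\mp\sqrt{\xi(p)^2e^{2x_0^2}-1}\Big)\right],$$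 $$J(p)=\frac{\sqrt\pi}2\Big\{|c_1|^2\big[\mathrm{erf}(x_+-x_0)-\mathrm{erf}(x_--x_0)\big]+|c_2|^2\big[\mathrm{erf}(x_++x_0)-\mathrm{erf}(x_-+x_0)\big]+2|c_1c_2|\xi(p)\big[\mathrm{erf}(x_+)-\mathrm{erf}(x_-)\big]\Big\}.$$ Consequently, $$\mathcal N_W(\chi)=\frac1{2\pi\Lambda}\int_{-\infty}^\infty dp\,e^{-p^2}\left(\int dx\,|B(x,p)|\right)-\frac12,$$ an exact expression reducing the negativity volume to a single numerical quadrature over $p$, with a closed-form integrand at every $p$. If $c_1=0$ or $c_2=0$, $|\chi\rangle$ is a coherent state up to normalization and $\mathcal N_W(\chi)=0$, so the nontrivial case is $c_1c_2\neq0$.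
   Context: Single bosonic mode with Hilbert space $L^2(\mathbb R)$, $\hbar=1$. For real $\alpha$ the coherent state $|\pm\alpha\rangle$ has position wavefunction $\psi_{\pm\alpha}(x)=\pi^{-1/4}e^{-(x\mp x_0)^2/2}$ with $x_0=\sqrt2\,\alpha$. The Wigner function of a pure state $\psi$ is $W(x,p)=\frac1{2\pi}\int_{-\infty}^\infty\psi(x+\tfrac y2)\,\psi^*(x-\tfrac y2)\,e^{-ipy}\,dy$, normalized so that $\int\!\int W\,dx\,dp=1$. The Wigner negativity is $\mathcal N_W(\rho)=\tfrac12\big(\int\!\int|W_\rho(x,p)|\,dx\,dp-1\big)$, and $\mathcal N_W(\chi)$ means $\mathcal N_W(|\chi\rangle\langle\chi|)$. Integrals over $x$ run over $\mathbb R$. $\mathrm{erf}(z)=\frac2{\sqrt\pi}\int_0^ze^{-t^2}dt$.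
   Formalization: For α<0 the displayed x_- and x_+ are exchanged (as displayed, they come out in decreasing order, J changes sign and the second case is false); for α=0, where 1/(2x_0) is undefined, J is 0; Λ≠0 is assumed so that the state is defined. *)

theory Defs
  imports "HOL-Analysis.Analysis"
begin

definition erf :: "real \<Rightarrow> real" where
  "erf z = 2 / sqrt pi * (LBINT t=ereal 0..ereal z. exp (- t\<^sup>2))"

text \<open>Pure states of the mode are given by their position wavefunctions.\<close>

definition wigner :: "(real \<Rightarrow> complex) \<Rightarrow> real \<Rightarrow> real \<Rightarrow> complex" where
  "wigner \<psi> x p = 1 / (2 * of_real pi) *
     (LINT y|lborel. \<psi> (x + y / 2) * cnj (\<psi> (x - y / 2)) * exp (- \<i> * of_real (p * y)))"

definition wigner_negativity :: "(real \<Rightarrow> complex) \<Rightarrow> real" where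
  "wigner_negativity \<psi> =
     1 / 2 * ((LINT z|(lborel :: (real \<times> real) measure). cmod (wigner \<psi> (fst z) (snd z))) - 1)"

definition disp :: "real \<Rightarrow> real" where
  "disp \<alpha> = sqrt 2 * \<alpha>"

definition coherent :: "real \<Rightarrow> real \<Rightarrow> complex" where
  "coherent \<alpha> x = of_real (pi powr (- 1 / 4) * exp (- (x - disp \<alpha>)\<^sup>2 / 2))"

definition cat_norm :: "real \<Rightarrow> complex \<Rightarrow> complex \<Rightarrow> real" where
  "cat_norm \<alpha> c\<^sub>1 c\<^sub>2 = (cmod c\<^sub>1)\<^sup>2 + (cmod c\<^sub>2)\<^sup>2 + 2 * Re (c\<^sub>1 * cnj c\<^sub>2) * exp (- 2 * \<alpha>\<^sup>2)"

definition cat_state :: "real \<Rightarrow> complex \<Rightarrow> complex \<Rightarrow> real \<Rightarrow> complex" where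
  "cat_state \<alpha> c\<^sub>1 c\<^sub>2 x =
     (c\<^sub>1 * coherent \<alpha> x + c\<^sub>2 * coherent (- \<alpha>) x) / of_real (sqrt (cat_norm \<alpha> c\<^sub>1 c\<^sub>2))"

definition cat_phase :: "complex \<Rightarrow> complex \<Rightarrow> real" where
  "cat_phase c\<^sub>1 c\<^sub>2 = Arg (c\<^sub>1 * cnj c\<^sub>2)"

definition cat_xi :: "real \<Rightarrow> complex \<Rightarrow> complex \<Rightarrow> real \<Rightarrow> real" where
  "cat_xi \<alpha> c\<^sub>1 c\<^sub>2 p = cos (2 * disp \<alpha> * p - cat_phase c\<^sub>1 c\<^sub>2)"

definition cat_B :: "real \<Rightarrow> complex \<Rightarrow> complex \<Rightarrow> real \<Rightarrow> real \<Rightarrow> real" where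
  "cat_B \<alpha> c\<^sub>1 c\<^sub>2 x p =
     (cmod c\<^sub>1)\<^sup>2 * exp (- (x - disp \<alpha>)\<^sup>2) + (cmod c\<^sub>2)\<^sup>2 * exp (- (x + disp \<alpha>)\<^sup>2)
       + 2 * cmod (c\<^sub>1 * c\<^sub>2) * cat_xi \<alpha> c\<^sub>1 c\<^sub>2 p * exp (- x\<^sup>2)"

text \<open>The zeros of \<^term>\<open>\<lambda>x. cat_B \<alpha> c\<^sub>1 c\<^sub>2 x p\<close>: the closed form with the inner
  sign \<open>s = -1\<close> or \<open>s = 1\<close>.\<close>

definition cat_root :: "real \<Rightarrow> real \<Rightarrow> complex \<Rightarrow> complex \<Rightarrow> real \<Rightarrow> real" where
  "cat_root s \<alpha> c\<^sub>1 c\<^sub>2 p =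
     1 / (2 * disp \<alpha>) *
       ln (sqrt ((cmod c\<^sub>2)\<^sup>2 / (cmod c\<^sub>1)\<^sup>2) *
           (- cat_xi \<alpha> c\<^sub>1 c\<^sub>2 p * exp ((disp \<alpha>)\<^sup>2)
              + s * sqrt ((cat_xi \<alpha> c\<^sub>1 c\<^sub>2 p)\<^sup>2 * exp (2 * (disp \<alpha>)\<^sup>2) - 1)))"

text \<open>The lower and the upper zero. The prefactor \<open>1 / (2 * disp \<alpha>)\<close> is negative for
  \<open>\<alpha> < 0\<close>, and then the sign \<open>s = -1\<close> gives the upper zero. For \<open>\<alpha> = 0\<close> the function
  \<^term>\<open>\<lambda>x. cat_B \<alpha> c\<^sub>1 c\<^sub>2 x p\<close> has no zeros (unless it vanishes identically); both values
  are then 0, and so is \<open>cat_J\<close> below.\<close>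

definition cat_x_minus :: "real \<Rightarrow> complex \<Rightarrow> complex \<Rightarrow> real \<Rightarrow> real" where
  "cat_x_minus \<alpha> c\<^sub>1 c\<^sub>2 p =
     (if 0 \<le> \<alpha> then cat_root (- 1) \<alpha> c\<^sub>1 c\<^sub>2 p else cat_root 1 \<alpha> c\<^sub>1 c\<^sub>2 p)"

definition cat_x_plus :: "real \<Rightarrow> complex \<Rightarrow> complex \<Rightarrow> real \<Rightarrow> real" where
  "cat_x_plus \<alpha> c\<^sub>1 c\<^sub>2 p =
     (if 0 \<le> \<alpha> then cat_root 1 \<alpha> c\<^sub>1 c\<^sub>2 p else cat_root (- 1) \<alpha> c\<^sub>1 c\<^sub>2 p)"

definition cat_J :: "real \<Rightarrow> complex \<Rightarrow> complex \<Rightarrow> real \<Rightarrow> real" where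
  "cat_J \<alpha> c\<^sub>1 c\<^sub>2 p =
     (let x\<^sub>0 = disp \<alpha>; x\<^sub>m = cat_x_minus \<alpha> c\<^sub>1 c\<^sub>2 p; x\<^sub>p = cat_x_plus \<alpha> c\<^sub>1 c\<^sub>2 p in
      sqrt pi / 2 *
        ((cmod c\<^sub>1)\<^sup>2 * (erf (x\<^sub>p - x\<^sub>0) - erf (x\<^sub>m - x\<^sub>0))
         + (cmod c\<^sub>2)\<^sup>2 * (erf (x\<^sub>p + x\<^sub>0) - erf (x\<^sub>m + x\<^sub>0))
         + 2 * cmod (c\<^sub>1 * c\<^sub>2) * cat_xi \<alpha> c\<^sub>1 c\<^sub>2 p * (erf x\<^sub>p - erf x\<^sub>m)))"

end

(* Each term of the superposition contributes a shifted Gaussian to the Wigner integral, evaluated by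
   the characteristic function of the normal distribution. In the variable
   w = |c1| / |c2| * exp (2 x0 x), strictly monotone in x if alpha is not 0, the bracket B is a positive factor times
   w^2 + 2 xi exp (x0^2) w + 1. The product of the roots is 1, so B is positive if
   xi exp (x0^2) > -1, and otherwise it is nonpositive exactly between the two positive roots. There
   |B| = B - 2 B 1_[x-, x+], and the last term is integrated with erf as antiderivative. Fubini's
   theorem gives the negativity. For alpha = 0, B is exp (-x^2) times the squared norm, hence positive. *)

theory Submission
  imports Defs "HOL-Probability.Characteristic_Functions"
begin

section \<open>Gaussian integrals and the error function\<close>

lemma has_bochner_integral_gaussian:
  fixes a :: real
  shows "has_bochner_integral lborel (\<lambda>x. exp (- (x - a)\<^sup>2)) (sqrt pi)"
proof -
  \<comment> \<open>Standard deviation \<open>1 / sqrt 2\<close> gives the exponent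
    \<open>- (x - a)\<^sup>2\<close>; the density then carries the factor
    \<open>1 / sqrt pi\<close>.\<close>
  have "has_bochner_integral lborel (normal_density a (1 / sqrt 2)) 1"
    by (simp add: has_bochner_integral_iff)
  from has_bochner_integral_mult_right[OF this, of "sqrt pi"]
  show ?thesis
    by (simp add: normal_density_def[abs_def] power_divide)
qed

text \<open>The substitution \<open>y = 2 * d + sqrt 2 * s\<close> turns the exponent into
  \<open>- s\<^sup>2 / 2\<close>. What remains is the characteristic function of the standard normal
  distribution at \<open>- sqrt 2 * p\<close>.\<close>

lemma has_bochner_integral_gaussian_fourier:
  fixes p d :: real
  shows "has_bochner_integral lborel (\<lambda>y. of_real (exp (- (y / 2 - d)\<^sup>2)) * exp (- \<i> * of_real (p * y)))
    (of_real (2 * sqrt pi * exp (- p\<^sup>2)) * exp (- \<i> * of_real (2 * p * d)))"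
    (is "has_bochner_integral _ ?f ?I")
proof -
  let ?t = "- sqrt 2 * p"
  let ?g = "\<lambda>s. of_real (std_normal_density s) * iexp (?t * s) :: complex"
  have int: "integrable lborel ?g"
    by (rule Bochner_Integration.integrable_bound[OF integrable_normal_density[where \<mu> = 0 and \<sigma> = 1]])
       (auto simp: norm_mult)
  have "(LINT s|lborel. ?g s) = char std_normal_distribution ?t"
    unfolding char_def by (subst integral_density) (auto simp: scaleR_conv_of_real)
  also have "\<dots> = of_real (exp (- p\<^sup>2))"
    by (simp add: char_std_normal_distribution power_mult_distrib)
  finally have "has_bochner_integral lborel ?g (of_real (exp (- p\<^sup>2)))"
    using int by (simp add: has_bochner_integral_iff)
  \<comment> \<open>The factor \<open>sqrt (2 * pi)\<close> cancels the normalization of the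
    density; the phase is what the shift \<open>2 * d\<close> contributes.\<close>
  from has_bochner_integral_mult_right[OF this, of "of_real (sqrt (2 * pi)) * exp (- \<i> * of_real (2 * p * d))"]
  have "has_bochner_integral lborel (\<lambda>s. of_real (sqrt (2 * pi)) * exp (- \<i> * of_real (2 * p * d)) * ?g s)
      (of_real (sqrt (2 * pi)) * exp (- \<i> * of_real (2 * p * d)) * of_real (exp (- p\<^sup>2)))"
    by simp
  moreover have "of_real (sqrt (2 * pi)) * exp (- \<i> * of_real (2 * p * d)) * ?g s = ?f (2 * d + sqrt 2 * s)" for s
  proof -
    have "((2 * d + sqrt 2 * s) / 2 - d)\<^sup>2 = s\<^sup>2 / 2"
      by (simp add: add_divide_distrib power_divide power_mult_distrib)
    moreover have "exp (- \<i> * of_real (2 * p * d)) * iexp (?t * s) = exp (- \<i> * of_real (p * (2 * d + sqrt 2 * s)))"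
      by (simp add: exp_add[symmetric] algebra_simps)
    moreover have "sqrt (2 * pi) * std_normal_density s = exp (- (s\<^sup>2 / 2))"
      by (simp add: std_normal_density_def)
    moreover have "of_real (sqrt (2 * pi)) * exp (- \<i> * of_real (2 * p * d)) * ?g s
        = of_real (sqrt (2 * pi) * std_normal_density s) * (exp (- \<i> * of_real (2 * p * d)) * iexp (?t * s))"
      by (simp only: of_real_mult mult_ac)
    ultimately show ?thesis
      by simp
  qed
  \<comment> \<open>Division by \<open>sqrt 2\<close> accounts for the Jacobian of the
    substitution.\<close>
  moreover have "of_real (sqrt (2 * pi)) * exp (- \<i> * of_real (2 * p * d)) * of_real (exp (- p\<^sup>2)) = ?I /\<^sub>R \<bar>sqrt 2\<bar>"
  proof -
    have "sqrt (2 * pi) = 2 * sqrt pi / sqrt 2"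
      by (simp add: real_sqrt_mult field_simps)
    then show ?thesis
      by (simp only: scaleR_conv_of_real of_real_divide of_real_mult) (simp add: field_simps)
  qed
  ultimately have "has_bochner_integral lborel (\<lambda>s. ?f (2 * d + sqrt 2 * s)) (?I /\<^sub>R \<bar>sqrt 2\<bar>)"
    by simp
  then show ?thesis
    by (subst lborel_has_bochner_integral_real_affine_iff[where c = "sqrt 2" and t = "2 * d"]) simp_all
qed

text \<open>Stated with an inner function \<open>g\<close>, so that shifted error functions are
  differentiated by \<open>derivative_intros\<close> directly.\<close>

lemma has_real_derivative_erf [derivative_intros]:
  assumes "(g has_real_derivative g') (at x within A)"
  shows "((\<lambda>x. erf (g x)) has_real_derivative 2 / sqrt pi * exp (- (g x)\<^sup>2) * g') (at x within A)"
proof -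
  have "(erf has_real_derivative 2 / sqrt pi * exp (- z\<^sup>2)) (at z)" for z
  proof -
    \<comment> \<open>The interval from \<open>- r\<close> to \<open>r\<close> contains the base
      point 0 for either sign of \<open>z\<close>, and has \<open>z\<close> in its interior, so the
      one-sided restriction of the filter disappears.\<close>
    define r where "r = \<bar>z\<bar> + 1"
    have "((\<lambda>u. LBINT t=ereal 0..ereal u. exp (- t\<^sup>2)) has_vector_derivative exp (- z\<^sup>2))
        (at z within {- r..r})"
      by (rule interval_integral_FTC2) (auto simp: r_def intro!: continuous_intros)
    moreover have "at z within {- r..r} = at z"
      by (rule at_within_interior) (auto simp: r_def)
    ultimately have "((\<lambda>u. LBINT t=ereal 0..ereal u. exp (- t\<^sup>2)) has_real_derivative exp (- z\<^sup>2)) (at z)"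
      by (simp add: has_real_derivative_iff_has_vector_derivative)
    from DERIV_cmult[OF this, of "2 / sqrt pi"] show ?thesis
      by (simp add: erf_def[abs_def])
  qed
  from DERIV_chain2[OF this assms] show ?thesis .
qed

section \<open>Wigner function and norm of the superposition\<close>

text \<open>With \<open>m\<close> the midpoint and \<open>d\<close> half the difference of the two
  centres, the parallelogram identity separates the exponent into \<open>(x - m)\<^sup>2\<close> and
  \<open>(y / 2 - d)\<^sup>2\<close>. The case \<open>a = b\<close> yields the Gaussian peaks,
  \<open>a = - b\<close> the interference terms.\<close>

lemma wigner_integral_coherent:
  "has_bochner_integral lborel
     (\<lambda>y. coherent a (x + y / 2) * cnj (coherent b (x - y / 2)) * exp (- \<i> * of_real (p * y)))
     (of_real (2 * exp (- (x - (disp a + disp b) / 2)\<^sup>2 - p\<^sup>2)) * exp (- \<i> * of_real (p * (disp a - disp b))))"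
proof -
  define d m where "d = (disp a - disp b) / 2" and "m = (disp a + disp b) / 2"
  have ab: "disp a = m + d" "disp b = m - d"
    by (simp_all add: d_def m_def field_simps)
  have pw: "pi powr (- 1 / 4) * pi powr (- 1 / 4) = 1 / sqrt pi"
    by (simp add: powr_add[symmetric] powr_minus_divide powr_half_sqrt)
  have *: "coherent a (x + y / 2) * cnj (coherent b (x - y / 2))
      = of_real (1 / sqrt pi * exp (- (x - m)\<^sup>2)) * of_real (exp (- (y / 2 - d)\<^sup>2))" for y
  proof -
    have "- (x + y / 2 - disp a)\<^sup>2 / 2 + - (x - y / 2 - disp b)\<^sup>2 / 2 = - (x - m)\<^sup>2 + - (y / 2 - d)\<^sup>2"
      unfolding ab by (simp add: power2_eq_square field_simps)
    then have "exp (- (x + y / 2 - disp a)\<^sup>2 / 2) * exp (- (x - y / 2 - disp b)\<^sup>2 / 2)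
        = exp (- (x - m)\<^sup>2) * exp (- (y / 2 - d)\<^sup>2)"
      by (simp only: exp_add[symmetric])
    then have "(pi powr (- 1 / 4) * exp (- (x + y / 2 - disp a)\<^sup>2 / 2)) * (pi powr (- 1 / 4) * exp (- (x - y / 2 - disp b)\<^sup>2 / 2))
        = 1 / sqrt pi * exp (- (x - m)\<^sup>2) * exp (- (y / 2 - d)\<^sup>2)"
      by (simp add: pw[symmetric])
    then show ?thesis
      by (simp only: coherent_def complex_cnj_complex_of_real of_real_mult[symmetric])
  qed
  have "of_real (1 / sqrt pi * exp (- (x - m)\<^sup>2)) * (of_real (2 * sqrt pi * exp (- p\<^sup>2)) * exp (- \<i> * of_real (2 * p * d)))
     = of_real (2 * exp (- (x - m)\<^sup>2 - p\<^sup>2)) * exp (- \<i> * of_real (p * (disp a - disp b)))"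
    by (simp add: exp_diff exp_minus ab mult_ac divide_simps)
  with has_bochner_integral_mult_right[OF has_bochner_integral_gaussian_fourier[of d p], of "of_real (1 / sqrt pi * exp (- (x - m)\<^sup>2))"]
  show ?thesis
    unfolding * m_def[symmetric] by (simp only: mult.assoc)
qed

lemma disp_minus [simp]: "disp (- \<alpha>) = - disp \<alpha>"
  by (simp add: disp_def)

lemma disp_power2: "(disp \<alpha>)\<^sup>2 = 2 * \<alpha>\<^sup>2"
  by (simp add: disp_def power_mult_distrib)

text \<open>Since the exponential is at most 1,
  \<open>(cmod c\<^sub>1 - cmod c\<^sub>2)\<^sup>2\<close> is a lower bound. This lets the square
  root in \<open>cat_state\<close> square back to \<open>cat_norm\<close>.\<close>

lemma cat_norm_nonneg: "0 \<le> cat_norm \<alpha> c\<^sub>1 c\<^sub>2"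
proof -
  have "\<bar>Re (c\<^sub>1 * cnj c\<^sub>2)\<bar> \<le> cmod c\<^sub>1 * cmod c\<^sub>2"
    using abs_Re_le_cmod[of "c\<^sub>1 * cnj c\<^sub>2"] by (simp add: norm_mult)
  then have "\<bar>Re (c\<^sub>1 * cnj c\<^sub>2) * exp (- 2 * \<alpha>\<^sup>2)\<bar> \<le> cmod c\<^sub>1 * cmod c\<^sub>2 * 1"
    unfolding abs_mult by (intro mult_mono) auto
  moreover have "0 \<le> (cmod c\<^sub>1 - cmod c\<^sub>2)\<^sup>2"
    by simp
  ultimately show ?thesis
    unfolding cat_norm_def power2_diff by linarith
qed

text \<open>The summands are conjugate, so the sum is twice a real part, read off in polar form. It
  merges the two interference terms into one cosine.\<close>

lemma phase_add_cnj:
  "z * exp (- \<i> * of_real \<theta>) + cnj z * exp (\<i> * of_real \<theta>) = of_real (2 * cmod z * cos (\<theta> - Arg z))"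
proof -
  have "z * exp (- \<i> * of_real \<theta>) = rcis (cmod z) (Arg z) * cis (- \<theta>)"
    by (simp add: rcis_cmod_Arg cis_conv_exp)
  also have "\<dots> = rcis (cmod z) (Arg z - \<theta>)"
    by (simp add: rcis_def cis_mult)
  finally have 1: "z * exp (- \<i> * of_real \<theta>) = rcis (cmod z) (Arg z - \<theta>)" .
  have "z * exp (- \<i> * of_real \<theta>) + cnj z * exp (\<i> * of_real \<theta>)
      = z * exp (- \<i> * of_real \<theta>) + cnj (z * exp (- \<i> * of_real \<theta>))"
    by (simp add: exp_cnj)
  also have "\<dots> = of_real (2 * Re (rcis (cmod z) (Arg z - \<theta>)))"
    unfolding 1 by (simp only: complex_add_cnj)
  finally show ?thesis
    by (simp add: cos_diff mult_ac)
qed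

text \<open>The Wigner integrand is sesquilinear in the state, which leaves four integrals over
  pairs of coherent states. If the norm vanishes, both sides are 0 because division by zero gives
  0.\<close>

lemma wigner_cat_state:
  "wigner (cat_state \<alpha> c\<^sub>1 c\<^sub>2) x p = of_real (exp (- p\<^sup>2) * cat_B \<alpha> c\<^sub>1 c\<^sub>2 x p / (pi * cat_norm \<alpha> c\<^sub>1 c\<^sub>2))"
proof -
  let ?\<Lambda> = "cat_norm \<alpha> c\<^sub>1 c\<^sub>2" and ?x0 = "disp \<alpha>"
  let ?T = "\<lambda>a b y. coherent a (x + y / 2) * cnj (coherent b (x - y / 2)) * exp (- \<i> * of_real (p * y))"
  let ?K = "\<lambda>a b. of_real (2 * exp (- (x - (disp a + disp b) / 2)\<^sup>2 - p\<^sup>2)) * exp (- \<i> * of_real (p * (disp a - disp b))) :: complex"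
  \<comment> \<open>The sesquilinear expansion, abstracted over \<open>T\<close> so that it applies
    both to the integrands \<open>?T\<close> and to their integrals \<open>?K\<close>.\<close>
  let ?S = "\<lambda>T. 1 / of_real ?\<Lambda> * ((c\<^sub>1 * cnj c\<^sub>1 * T \<alpha> \<alpha> + c\<^sub>2 * cnj c\<^sub>2 * T (- \<alpha>) (- \<alpha>))
      + (c\<^sub>1 * cnj c\<^sub>2 * T \<alpha> (- \<alpha>) + cnj (c\<^sub>1 * cnj c\<^sub>2) * T (- \<alpha>) \<alpha>)) :: complex"
  have T: "has_bochner_integral lborel (?T a b) (?K a b)" for a b
    by (rule wigner_integral_coherent)
  have sq: "complex_of_real (sqrt ?\<Lambda>) * of_real (sqrt ?\<Lambda>) = of_real ?\<Lambda>"
    by (simp only: of_real_mult[symmetric] real_sqrt_mult_self abs_of_nonneg[OF cat_norm_nonneg])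
  have "cat_state \<alpha> c\<^sub>1 c\<^sub>2 (x + y / 2) * cnj (cat_state \<alpha> c\<^sub>1 c\<^sub>2 (x - y / 2)) * exp (- \<i> * of_real (p * y))
      = ?S (\<lambda>a b. ?T a b y)" for y
  proof -
    \<comment> \<open>Free \<open>k\<^sub>1\<close> and \<open>k\<^sub>2\<close> stand for the
      conjugate coefficients, which makes the expansion plain field algebra.\<close>
    have "(c\<^sub>1 * A + c\<^sub>2 * B) / s * ((k\<^sub>1 * C + k\<^sub>2 * D) / s) * e = 1 / (s * s) *
        ((c\<^sub>1 * k\<^sub>1 * (A * C * e) + c\<^sub>2 * k\<^sub>2 * (B * D * e)) + (c\<^sub>1 * k\<^sub>2 * (A * D * e) + k\<^sub>1 * c\<^sub>2 * (B * C * e)))"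
      for A B C D k\<^sub>1 k\<^sub>2 s e :: complex
      by (simp add: ring_distribs mult_ac add_divide_distrib)
    from this[where k\<^sub>1 = "cnj c\<^sub>1" and k\<^sub>2 = "cnj c\<^sub>2" and s = "of_real (sqrt ?\<Lambda>)"] show ?thesis
      unfolding cat_state_def sq
      by (simp only: complex_cnj_divide complex_cnj_add complex_cnj_mult complex_cnj_complex_of_real complex_cnj_cnj)
  qed
  moreover have "has_bochner_integral lborel (\<lambda>y. ?S (\<lambda>a b. ?T a b y)) (?S ?K)"
    by (intro has_bochner_integral_mult_right has_bochner_integral_add T)
  ultimately have "wigner (cat_state \<alpha> c\<^sub>1 c\<^sub>2) x p = 1 / (2 * of_real pi) * ?S ?K"
    unfolding wigner_def by (simp only: has_bochner_integral_integral_eq)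
  also have "?S ?K = of_real (2 * exp (- p\<^sup>2) * cat_B \<alpha> c\<^sub>1 c\<^sub>2 x p / ?\<Lambda>)"
  proof -
    \<comment> \<open>The midpoint of the centres is 0 in both cross terms, so they share one
      Gaussian and differ only by conjugate factors.\<close>
    have "c\<^sub>1 * cnj c\<^sub>2 * ?K \<alpha> (- \<alpha>) + cnj (c\<^sub>1 * cnj c\<^sub>2) * ?K (- \<alpha>) \<alpha>
        = of_real (2 * exp (- x\<^sup>2 - p\<^sup>2)) * (c\<^sub>1 * cnj c\<^sub>2 * exp (- \<i> * of_real (2 * ?x0 * p))
            + cnj (c\<^sub>1 * cnj c\<^sub>2) * exp (\<i> * of_real (2 * ?x0 * p)))"
      by (simp add: algebra_simps)
    also have "\<dots> = of_real (2 * exp (- x\<^sup>2 - p\<^sup>2)) * of_real (2 * cmod (c\<^sub>1 * c\<^sub>2) * cat_xi \<alpha> c\<^sub>1 c\<^sub>2 p)"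
      unfolding phase_add_cnj by (simp add: cat_xi_def cat_phase_def norm_mult)
    finally have 1: "c\<^sub>1 * cnj c\<^sub>2 * ?K \<alpha> (- \<alpha>) + cnj (c\<^sub>1 * cnj c\<^sub>2) * ?K (- \<alpha>) \<alpha>
        = of_real (2 * exp (- x\<^sup>2 - p\<^sup>2) * (2 * cmod (c\<^sub>1 * c\<^sub>2) * cat_xi \<alpha> c\<^sub>1 c\<^sub>2 p))"
      by simp
    have 2: "c * cnj c * ?K a a = of_real (2 * (cmod c)\<^sup>2 * exp (- (x - disp a)\<^sup>2 - p\<^sup>2))" for c a
      by (simp add: complex_norm_square[symmetric])
    have 3: "2 * (cmod c\<^sub>1)\<^sup>2 * exp (- (x - ?x0)\<^sup>2 - p\<^sup>2) + 2 * (cmod c\<^sub>2)\<^sup>2 * exp (- (x - disp (- \<alpha>))\<^sup>2 - p\<^sup>2)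
        + 2 * exp (- x\<^sup>2 - p\<^sup>2) * (2 * cmod (c\<^sub>1 * c\<^sub>2) * cat_xi \<alpha> c\<^sub>1 c\<^sub>2 p) = 2 * exp (- p\<^sup>2) * cat_B \<alpha> c\<^sub>1 c\<^sub>2 x p"
      unfolding cat_B_def diff_conv_add_uminus[of _ "p\<^sup>2"] exp_add by (simp add: algebra_simps)
    show ?thesis
      unfolding 1 2 3[symmetric] by simp
  qed
  finally show ?thesis
    by simp
qed

text \<open>The product \<open>u * v\<close> of the two wave packets is a Gaussian centred at 0
  times \<open>exp (- 2 * \<alpha>\<^sup>2)\<close>; this overlap is the source of the last term of
  \<open>cat_norm\<close>.\<close>

lemma has_bochner_integral_cat_state:
  assumes "cat_norm \<alpha> c\<^sub>1 c\<^sub>2 \<noteq> 0"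
  shows "has_bochner_integral lborel (\<lambda>x. (cmod (cat_state \<alpha> c\<^sub>1 c\<^sub>2 x))\<^sup>2) 1"
proof -
  let ?\<Lambda> = "cat_norm \<alpha> c\<^sub>1 c\<^sub>2" and ?x0 = "disp \<alpha>"
  \<comment> \<open>The forms \<open>x - (- ?x0)\<close> and \<open>x - 0\<close> match the Gaussian
    lemma syntactically.\<close>
  let ?f = "\<lambda>x. 1 / (sqrt pi * ?\<Lambda>) * ((cmod c\<^sub>1)\<^sup>2 * exp (- (x - ?x0)\<^sup>2) + (cmod c\<^sub>2)\<^sup>2 * exp (- (x - (- ?x0))\<^sup>2)
      + 2 * Re (c\<^sub>1 * cnj c\<^sub>2) * exp (- 2 * \<alpha>\<^sup>2) * exp (- (x - 0)\<^sup>2))"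
  have pw: "(pi powr (- 1 / 4))\<^sup>2 = 1 / sqrt pi"
    by (simp add: power2_eq_square powr_add[symmetric] powr_minus_divide powr_half_sqrt)
  have "(cmod (cat_state \<alpha> c\<^sub>1 c\<^sub>2 x))\<^sup>2 = ?f x" for x
  proof -
    define u v where "u = exp (- (x - ?x0)\<^sup>2 / 2)" and "v = exp (- (x - (- ?x0))\<^sup>2 / 2)"
    have uv: "u\<^sup>2 = exp (- (x - ?x0)\<^sup>2)" "v\<^sup>2 = exp (- (x - (- ?x0))\<^sup>2)"
      by (simp_all add: u_def v_def exp_double[symmetric])
    have "- (x - ?x0)\<^sup>2 / 2 + - (x - (- ?x0))\<^sup>2 / 2 = - 2 * \<alpha>\<^sup>2 + - (x - 0)\<^sup>2"
      using disp_power2[of \<alpha>] by (simp add: power2_eq_square field_simps)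
    then have uv2: "u * v = exp (- 2 * \<alpha>\<^sup>2) * exp (- (x - 0)\<^sup>2)"
      unfolding u_def v_def by (simp only: exp_add[symmetric])
    have coh: "coherent \<alpha> x = of_real (pi powr (- 1 / 4)) * of_real u"
      "coherent (- \<alpha>) x = of_real (pi powr (- 1 / 4)) * of_real v"
      by (simp_all add: coherent_def u_def v_def)
    have "cat_state \<alpha> c\<^sub>1 c\<^sub>2 x = of_real (pi powr (- 1 / 4) / sqrt ?\<Lambda>) * (c\<^sub>1 * of_real u + c\<^sub>2 * of_real v)"
      unfolding cat_state_def coh by (simp add: field_simps)
    then have "(cmod (cat_state \<alpha> c\<^sub>1 c\<^sub>2 x))\<^sup>2 = (pi powr (- 1 / 4))\<^sup>2 / (sqrt ?\<Lambda>)\<^sup>2 * (cmod (c\<^sub>1 * of_real u + c\<^sub>2 * of_real v))\<^sup>2"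
      by (simp only: norm_mult norm_of_real power_mult_distrib power2_abs power_divide)
    also have "(cmod (c\<^sub>1 * of_real u + c\<^sub>2 * of_real v))\<^sup>2
        = (cmod c\<^sub>1)\<^sup>2 * u\<^sup>2 + (cmod c\<^sub>2)\<^sup>2 * v\<^sup>2 + 2 * Re (c\<^sub>1 * cnj c\<^sub>2) * (u * v)"
      unfolding cmod_power2 by (simp add: power2_eq_square algebra_simps)
    finally show ?thesis
      unfolding uv uv2 pw using cat_norm_nonneg[of \<alpha> c\<^sub>1 c\<^sub>2] by (simp add: mult.assoc)
  qed
  moreover have "has_bochner_integral lborel ?f (1 / (sqrt pi * ?\<Lambda>) * ((cmod c\<^sub>1)\<^sup>2 * sqrt pi + (cmod c\<^sub>2)\<^sup>2 * sqrt pi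
      + 2 * Re (c\<^sub>1 * cnj c\<^sub>2) * exp (- 2 * \<alpha>\<^sup>2) * sqrt pi))"
    by (intro has_bochner_integral_mult_right has_bochner_integral_add has_bochner_integral_gaussian)
  moreover have "(cmod c\<^sub>1)\<^sup>2 * sqrt pi + (cmod c\<^sub>2)\<^sup>2 * sqrt pi
      + 2 * Re (c\<^sub>1 * cnj c\<^sub>2) * exp (- 2 * \<alpha>\<^sup>2) * sqrt pi = sqrt pi * ?\<Lambda>"
    unfolding cat_norm_def by (simp add: algebra_simps)
  ultimately show ?thesis
    using assms by simp
qed

section \<open>Integrals of \<open>cat_B\<close> and reduction of the negativity by Fubini's
  theorem\<close>

lemma has_bochner_integral_cat_B:
  "has_bochner_integral lborel (\<lambda>x. cat_B \<alpha> c\<^sub>1 c\<^sub>2 x p)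
     (sqrt pi * ((cmod c\<^sub>1)\<^sup>2 + (cmod c\<^sub>2)\<^sup>2 + 2 * cmod (c\<^sub>1 * c\<^sub>2) * cat_xi \<alpha> c\<^sub>1 c\<^sub>2 p))"
proof -
  let ?x0 = "disp \<alpha>" and ?k = "2 * cmod (c\<^sub>1 * c\<^sub>2) * cat_xi \<alpha> c\<^sub>1 c\<^sub>2 p"
  have "has_bochner_integral lborel (\<lambda>x. (cmod c\<^sub>1)\<^sup>2 * exp (- (x - ?x0)\<^sup>2)
      + (cmod c\<^sub>2)\<^sup>2 * exp (- (x - (- ?x0))\<^sup>2) + ?k * exp (- (x - 0)\<^sup>2))
      ((cmod c\<^sub>1)\<^sup>2 * sqrt pi + (cmod c\<^sub>2)\<^sup>2 * sqrt pi + ?k * sqrt pi)"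
    by (intro has_bochner_integral_mult_right has_bochner_integral_add has_bochner_integral_gaussian)
  moreover have "(cmod c\<^sub>1)\<^sup>2 * sqrt pi + (cmod c\<^sub>2)\<^sup>2 * sqrt pi + ?k * sqrt pi
      = sqrt pi * ((cmod c\<^sub>1)\<^sup>2 + (cmod c\<^sub>2)\<^sup>2 + ?k)"
    by (simp add: algebra_simps)
  ultimately show ?thesis
    by (simp add: cat_B_def)
qed

lemma integrable_mult_fst_snd:
  fixes f g :: "real \<Rightarrow> real"
  assumes "integrable lborel f" "integrable lborel g"
  shows "integrable lborel (\<lambda>z. f (fst z) * g (snd z))"
proof -
  have [measurable]: "f \<in> borel_measurable borel" "g \<in> borel_measurable borel"
    using assms by (auto dest: borel_measurable_integrable)
  have "integrable (lborel \<Otimes>\<^sub>M lborel) (\<lambda>z. f (fst z) * g (snd z))"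
    by (rule lborel_pair.Fubini_integrable) (use assms in \<open>auto simp: abs_mult\<close>)
  then show ?thesis
    by (simp only: lborel_prod)
qed

text \<open>Each of the three terms is a function of \<open>x\<close> times a function of
  \<open>p\<close>, and the cosine in the third is bounded by 1. This supplies the hypothesis of
  Fubini's theorem.\<close>

lemma integrable_cat_B_prod:
  "integrable lborel (\<lambda>z :: real \<times> real. exp (- (snd z)\<^sup>2) * cat_B \<alpha> c\<^sub>1 c\<^sub>2 (fst z) (snd z))"
proof -
  have g: "integrable lborel (\<lambda>x. exp (- (x - a)\<^sup>2))" for a :: real
    using has_bochner_integral_gaussian by (simp add: has_bochner_integral_iff)
  have "integrable lborel (\<lambda>p :: real. exp (- p\<^sup>2))"
    using g[of 0] by simp
  moreover from this have "integrable lborel (\<lambda>p. exp (- p\<^sup>2) * cat_xi \<alpha> c\<^sub>1 c\<^sub>2 p)"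
    by (rule Bochner_Integration.integrable_bound)
       (auto simp: cat_xi_def abs_mult intro!: mult_left_le)
  ultimately have "integrable lborel (\<lambda>z :: real \<times> real.
        (cmod c\<^sub>1)\<^sup>2 * (exp (- (fst z - disp \<alpha>)\<^sup>2) * exp (- (snd z)\<^sup>2))
      + (cmod c\<^sub>2)\<^sup>2 * (exp (- (fst z - (- disp \<alpha>))\<^sup>2) * exp (- (snd z)\<^sup>2))
      + 2 * cmod (c\<^sub>1 * c\<^sub>2) * (exp (- (fst z - 0)\<^sup>2) * (exp (- (snd z)\<^sup>2) * cat_xi \<alpha> c\<^sub>1 c\<^sub>2 (snd z))))"
    by (intro Bochner_Integration.integrable_add integrable_mult_right)
       (rule integrable_mult_fst_snd[OF g], assumption)+
  then show ?thesis
    by (simp add: cat_B_def algebra_simps)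
qed

text \<open>The positive factor \<open>exp (- p\<^sup>2)\<close> leaves the absolute value and then
  the inner integral over \<open>x\<close>. The coefficients are arbitrary, so the coherent case can
  use the formula too.\<close>

lemma wigner_negativity_cat_state:
  shows "integrable lborel (\<lambda>p. exp (- p\<^sup>2) * (LINT x|lborel. \<bar>cat_B \<alpha> c\<^sub>1 c\<^sub>2 x p\<bar>))"
    and "wigner_negativity (cat_state \<alpha> c\<^sub>1 c\<^sub>2) =
      1 / (2 * pi * cat_norm \<alpha> c\<^sub>1 c\<^sub>2) *
        (LINT p|lborel. exp (- p\<^sup>2) * (LINT x|lborel. \<bar>cat_B \<alpha> c\<^sub>1 c\<^sub>2 x p\<bar>)) - 1 / 2"
proof -
  let ?\<Lambda> = "cat_norm \<alpha> c\<^sub>1 c\<^sub>2"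
  let ?h = "\<lambda>x p. exp (- p\<^sup>2) * \<bar>cat_B \<alpha> c\<^sub>1 c\<^sub>2 x p\<bar>"
  have "integrable (lborel \<Otimes>\<^sub>M lborel) (\<lambda>z. norm (exp (- (snd z)\<^sup>2) * cat_B \<alpha> c\<^sub>1 c\<^sub>2 (fst z) (snd z)))"
    using integrable_norm[OF integrable_cat_B_prod] by (simp only: lborel_prod)
  then have h: "integrable (lborel \<Otimes>\<^sub>M lborel) (case_prod ?h)"
    by (simp add: abs_mult case_prod_beta')
  from lborel_pair.integrable_snd[OF h]
  show "integrable lborel (\<lambda>p. exp (- p\<^sup>2) * (LINT x|lborel. \<bar>cat_B \<alpha> c\<^sub>1 c\<^sub>2 x p\<bar>))"
    by simp
  have "cmod (wigner (cat_state \<alpha> c\<^sub>1 c\<^sub>2) (fst z) (snd z)) = 1 / (pi * ?\<Lambda>) * case_prod ?h z" for z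
    unfolding wigner_cat_state norm_of_real
    using cat_norm_nonneg[of \<alpha> c\<^sub>1 c\<^sub>2] by (simp add: abs_mult case_prod_beta')
  then have "(LINT z|lborel. cmod (wigner (cat_state \<alpha> c\<^sub>1 c\<^sub>2) (fst z) (snd z)))
      = 1 / (pi * ?\<Lambda>) * (LINT z|lborel. case_prod ?h z)"
    by (simp only: integral_mult_right_zero)
  also have "(LINT z|lborel. case_prod ?h z) = (LINT p|lborel. LINT x|lborel. ?h x p)"
    using lborel_pair.integral_snd[OF h] by (simp only: lborel_prod)
  finally show "wigner_negativity (cat_state \<alpha> c\<^sub>1 c\<^sub>2) =
      1 / (2 * pi * ?\<Lambda>) * (LINT p|lborel. exp (- p\<^sup>2) * (LINT x|lborel. \<bar>cat_B \<alpha> c\<^sub>1 c\<^sub>2 x p\<bar>)) - 1 / 2"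
    unfolding wigner_negativity_def by (simp add: field_simps)
qed

text \<open>The increment of this primitive from \<open>cat_x_minus\<close> to
  \<open>cat_x_plus\<close> is \<open>cat_J\<close>.\<close>

lemma has_real_derivative_cat_B_primitive:
  "((\<lambda>x. sqrt pi / 2 * ((cmod c\<^sub>1)\<^sup>2 * erf (x - disp \<alpha>) + (cmod c\<^sub>2)\<^sup>2 * erf (x + disp \<alpha>)
      + 2 * cmod (c\<^sub>1 * c\<^sub>2) * cat_xi \<alpha> c\<^sub>1 c\<^sub>2 p * erf x)) has_real_derivative cat_B \<alpha> c\<^sub>1 c\<^sub>2 x p) (at x)"
  by (auto intro!: derivative_eq_intros simp: cat_B_def field_simps)

lemma has_bochner_integral_cat_B_roots:
  assumes "cat_x_minus \<alpha> c\<^sub>1 c\<^sub>2 p \<le> cat_x_plus \<alpha> c\<^sub>1 c\<^sub>2 p"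
  shows "has_bochner_integral lborel
    (\<lambda>x. cat_B \<alpha> c\<^sub>1 c\<^sub>2 x p * indicator {cat_x_minus \<alpha> c\<^sub>1 c\<^sub>2 p..cat_x_plus \<alpha> c\<^sub>1 c\<^sub>2 p} x) (cat_J \<alpha> c\<^sub>1 c\<^sub>2 p)"
proof -
  have "isCont (\<lambda>x. cat_B \<alpha> c\<^sub>1 c\<^sub>2 x p) x" for x
    unfolding cat_B_def by (intro continuous_intros)
  from has_bochner_integral_FTC_Icc_real[OF assms has_real_derivative_cat_B_primitive this]
  show ?thesis
    by (simp add: cat_J_def Let_def algebra_simps)
qed

section \<open>Sign and zeros of \<open>cat_B\<close>\<close>

text \<open>At zero displacement \<open>cat_xi\<close> is the cosine of the phase, so
  \<open>cat_B\<close> equals \<open>exp (- x\<^sup>2)\<close> times the norm. The value may fall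
  into the second branch of the integral formula, when the cosine is -1, and still no zeros
  exist.\<close>

lemma cat_B_zero_displacement_pos:
  assumes "cat_norm 0 c\<^sub>1 c\<^sub>2 \<noteq> 0"
  shows "cat_B 0 c\<^sub>1 c\<^sub>2 x p > 0"
proof -
  have "Re (c\<^sub>1 * cnj c\<^sub>2) = cmod (c\<^sub>1 * c\<^sub>2) * cos (cat_phase c\<^sub>1 c\<^sub>2)"
  proof -
    have "Re (c\<^sub>1 * cnj c\<^sub>2) = Re (rcis (cmod (c\<^sub>1 * cnj c\<^sub>2)) (Arg (c\<^sub>1 * cnj c\<^sub>2)))"
      by (simp only: rcis_cmod_Arg)
    then show ?thesis
      by (simp only: Re_rcis cat_phase_def norm_mult complex_mod_cnj)
  qed
  then have "cat_B 0 c\<^sub>1 c\<^sub>2 x p = exp (- x\<^sup>2) * cat_norm 0 c\<^sub>1 c\<^sub>2"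
    by (simp add: cat_B_def cat_norm_def cat_xi_def disp_def algebra_simps)
  moreover have "cat_norm 0 c\<^sub>1 c\<^sub>2 > 0"
    using assms cat_norm_nonneg[of 0 c\<^sub>1 c\<^sub>2] by simp
  ultimately show ?thesis
    by simp
qed

text \<open>This is the ratio of the moduli of the two components,
  \<open>c\<^sub>1 * coherent \<alpha> x\<close> over
  \<open>c\<^sub>2 * coherent (- \<alpha>) x\<close>.\<close>

definition cat_ratio :: "real \<Rightarrow> complex \<Rightarrow> complex \<Rightarrow> real \<Rightarrow> real" where
  "cat_ratio \<alpha> c\<^sub>1 c\<^sub>2 x = cmod c\<^sub>1 / cmod c\<^sub>2 * exp (2 * disp \<alpha> * x)"

text \<open>Factoring out the second Gaussian peak leaves a quadratic in the ratio whose
  coefficients do not depend on \<open>x\<close>.\<close>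

lemma cat_B_quadratic:
  assumes "c\<^sub>1 \<noteq> 0" "c\<^sub>2 \<noteq> 0"
  shows "cat_B \<alpha> c\<^sub>1 c\<^sub>2 x p = (cmod c\<^sub>2)\<^sup>2 * exp (- (x + disp \<alpha>)\<^sup>2) *
    ((cat_ratio \<alpha> c\<^sub>1 c\<^sub>2 x)\<^sup>2 + 2 * (cat_xi \<alpha> c\<^sub>1 c\<^sub>2 p * exp ((disp \<alpha>)\<^sup>2)) * cat_ratio \<alpha> c\<^sub>1 c\<^sub>2 x + 1)"
proof -
  define t where "t = exp (2 * disp \<alpha> * x)"
  have 1: "exp (- (x - disp \<alpha>)\<^sup>2) = exp (- (x + disp \<alpha>)\<^sup>2) * t\<^sup>2"
    unfolding t_def exp_double[symmetric] exp_add[symmetric]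
    by (simp add: power2_eq_square algebra_simps)
  have 2: "exp (- x\<^sup>2) = exp (- (x + disp \<alpha>)\<^sup>2) * (exp ((disp \<alpha>)\<^sup>2) * t)"
    unfolding t_def exp_add[symmetric] by (simp add: power2_eq_square algebra_simps)
  show ?thesis
    unfolding cat_B_def cat_ratio_def t_def[symmetric] 1 2 norm_mult
    using assms by (simp add: power2_eq_square field_simps)
qed

text \<open>The quadratic is \<open>(?w - 1)\<^sup>2 + 2 * (?k + 1) * ?w\<close>, with
  \<open>?w > 0\<close> and \<open>?k > - 1\<close>.\<close>

lemma cat_B_pos:
  assumes "c\<^sub>1 \<noteq> 0" "c\<^sub>2 \<noteq> 0" "cat_xi \<alpha> c\<^sub>1 c\<^sub>2 p > - exp (- (disp \<alpha>)\<^sup>2)"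
  shows "cat_B \<alpha> c\<^sub>1 c\<^sub>2 x p > 0"
proof -
  let ?w = "cat_ratio \<alpha> c\<^sub>1 c\<^sub>2 x" and ?k = "cat_xi \<alpha> c\<^sub>1 c\<^sub>2 p * exp ((disp \<alpha>)\<^sup>2)"
  have "- 1 < ?k"
    using assms(3) by (simp add: exp_minus field_simps)
  moreover have "0 < ?w"
    using assms by (simp add: cat_ratio_def)
  ultimately have "0 < (?w - 1)\<^sup>2 + 2 * (?k + 1) * ?w"
    by (intro add_nonneg_pos) auto
  also have "\<dots> = ?w\<^sup>2 + 2 * ?k * ?w + 1"
    by (simp add: power2_eq_square algebra_simps)
  finally show ?thesis
    unfolding cat_B_quadratic[OF assms(1,2)] using assms by simp
qed

text \<open>The closed form inverts \<open>cat_ratio\<close>: the quotient of moduli under the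
  logarithm and the prefactor of \<open>cat_root\<close> both cancel.\<close>

lemma cat_ratio_cat_root:
  assumes "c\<^sub>1 \<noteq> 0" "c\<^sub>2 \<noteq> 0" "\<alpha> \<noteq> 0"
    and "r = - cat_xi \<alpha> c\<^sub>1 c\<^sub>2 p * exp ((disp \<alpha>)\<^sup>2)
      + s * sqrt ((cat_xi \<alpha> c\<^sub>1 c\<^sub>2 p)\<^sup>2 * exp (2 * (disp \<alpha>)\<^sup>2) - 1)"
    and "0 < r"
  shows "cat_ratio \<alpha> c\<^sub>1 c\<^sub>2 (cat_root s \<alpha> c\<^sub>1 c\<^sub>2 p) = r"
proof -
  have "disp \<alpha> \<noteq> 0"
    using assms(3) by (simp add: disp_def)
  then have "2 * disp \<alpha> * cat_root s \<alpha> c\<^sub>1 c\<^sub>2 p = ln (cmod c\<^sub>2 / cmod c\<^sub>1 * r)"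
    unfolding cat_root_def assms(4)[symmetric] by (simp add: real_sqrt_divide)
  then show ?thesis
    using assms(1,2,5) by (simp add: cat_ratio_def)
qed

text \<open>For negative \<alpha> the ratio decreases in \<open>x\<close>, which matches the
  exchange of signs in \<open>cat_x_minus\<close> and \<open>cat_x_plus\<close>.\<close>

lemma cat_ratio_le_iff:
  assumes "c\<^sub>1 \<noteq> 0" "c\<^sub>2 \<noteq> 0" "\<alpha> \<noteq> 0"
  shows "cat_ratio \<alpha> c\<^sub>1 c\<^sub>2 x \<le> cat_ratio \<alpha> c\<^sub>1 c\<^sub>2 y \<longleftrightarrow> (if 0 \<le> \<alpha> then x \<le> y else y \<le> x)"
proof -
  have "0 < cmod c\<^sub>1 / cmod c\<^sub>2"
    using assms by simp
  then have "cat_ratio \<alpha> c\<^sub>1 c\<^sub>2 x \<le> cat_ratio \<alpha> c\<^sub>1 c\<^sub>2 y \<longleftrightarrow> 2 * disp \<alpha> * x \<le> 2 * disp \<alpha> * y"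
    unfolding cat_ratio_def by (simp only: mult_le_cancel_left_pos exp_le_cancel_iff)
  then show ?thesis
    using assms(3) by (auto simp: disp_def mult_le_cancel_left zero_less_mult_iff mult_less_0_iff)
qed

text \<open>With \<open>k \<ge> 1\<close> minus half the linear coefficient, the quadratic has the
  real roots \<open>k - q\<close> and \<open>k + q\<close>, where
  \<open>q = sqrt (k\<^sup>2 - 1)\<close>.\<close>

lemma cat_B_factorization:
  assumes "c\<^sub>1 \<noteq> 0" "c\<^sub>2 \<noteq> 0" "\<alpha> \<noteq> 0" and le: "cat_xi \<alpha> c\<^sub>1 c\<^sub>2 p \<le> - exp (- (disp \<alpha>)\<^sup>2)"
  defines "w \<equiv> cat_ratio \<alpha> c\<^sub>1 c\<^sub>2"
  shows "cat_x_minus \<alpha> c\<^sub>1 c\<^sub>2 p \<le> cat_x_plus \<alpha> c\<^sub>1 c\<^sub>2 p"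
    and "cat_B \<alpha> c\<^sub>1 c\<^sub>2 x p = (cmod c\<^sub>2)\<^sup>2 * exp (- (x + disp \<alpha>)\<^sup>2) *
      ((w x - w (cat_x_minus \<alpha> c\<^sub>1 c\<^sub>2 p)) * (w x - w (cat_x_plus \<alpha> c\<^sub>1 c\<^sub>2 p)))"
proof -
  define k where "k = - cat_xi \<alpha> c\<^sub>1 c\<^sub>2 p * exp ((disp \<alpha>)\<^sup>2)"
  have "1 \<le> k"
    using le by (simp add: k_def exp_minus field_simps)
  then have k2: "1 \<le> k\<^sup>2"
    by simp
  define q where "q = sqrt ((cat_xi \<alpha> c\<^sub>1 c\<^sub>2 p)\<^sup>2 * exp (2 * (disp \<alpha>)\<^sup>2) - 1)"
  have "q = sqrt (k\<^sup>2 - 1)"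
    by (simp add: q_def k_def power_mult_distrib exp_double)
  with k2 have q: "q\<^sup>2 = k\<^sup>2 - 1" "0 \<le> q"
    by simp_all
  \<comment> \<open>This keeps the smaller root positive, so its logarithm in
    \<open>cat_root\<close> is genuine.\<close>
  have "q < k"
    by (rule power2_less_imp_less) (use q \<open>1 \<le> k\<close> in auto)
  have root: "w (cat_root s \<alpha> c\<^sub>1 c\<^sub>2 p) = k + s * q" if "0 < k + s * q" for s
    unfolding w_def by (rule cat_ratio_cat_root[OF assms(1-3) _ that]) (simp only: k_def q_def)
  have w: "w (cat_root (- 1) \<alpha> c\<^sub>1 c\<^sub>2 p) = k - q" "w (cat_root 1 \<alpha> c\<^sub>1 c\<^sub>2 p) = k + q"
    using root[of "- 1"] root[of 1] \<open>q < k\<close> q(2) by simp_all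
  have "w (cat_root (- 1) \<alpha> c\<^sub>1 c\<^sub>2 p) \<le> w (cat_root 1 \<alpha> c\<^sub>1 c\<^sub>2 p)"
    unfolding w using q(2) by simp
  then show "cat_x_minus \<alpha> c\<^sub>1 c\<^sub>2 p \<le> cat_x_plus \<alpha> c\<^sub>1 c\<^sub>2 p"
    unfolding w_def cat_ratio_le_iff[OF assms(1-3)] by (simp add: cat_x_minus_def cat_x_plus_def split: if_splits)
  have "(w x)\<^sup>2 + 2 * (cat_xi \<alpha> c\<^sub>1 c\<^sub>2 p * exp ((disp \<alpha>)\<^sup>2)) * w x + 1 = (w x)\<^sup>2 - 2 * k * w x + (k\<^sup>2 - q\<^sup>2)"
    by (simp add: q(1)) (simp add: k_def)
  also have "\<dots> = (w x - (k - q)) * (w x - (k + q))"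
    by (simp add: power2_eq_square algebra_simps)
  also have "\<dots> = (w x - w (cat_x_minus \<alpha> c\<^sub>1 c\<^sub>2 p)) * (w x - w (cat_x_plus \<alpha> c\<^sub>1 c\<^sub>2 p))"
    by (simp add: cat_x_minus_def cat_x_plus_def w)
  finally show "cat_B \<alpha> c\<^sub>1 c\<^sub>2 x p = (cmod c\<^sub>2)\<^sup>2 * exp (- (x + disp \<alpha>)\<^sup>2) *
      ((w x - w (cat_x_minus \<alpha> c\<^sub>1 c\<^sub>2 p)) * (w x - w (cat_x_plus \<alpha> c\<^sub>1 c\<^sub>2 p)))"
    unfolding cat_B_quadratic[OF assms(1,2)] w_def by simp
qed

text \<open>The prefactor is positive and the ratio is strictly monotone, so the sign of the product
  of the two differences locates \<open>x\<close> relative to the roots. The direction of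
  monotonicity does not change the outcome.\<close>

lemma cat_B_sign:
  assumes "c\<^sub>1 \<noteq> 0" "c\<^sub>2 \<noteq> 0" "\<alpha> \<noteq> 0" "cat_xi \<alpha> c\<^sub>1 c\<^sub>2 p \<le> - exp (- (disp \<alpha>)\<^sup>2)"
  shows "cat_B \<alpha> c\<^sub>1 c\<^sub>2 x p \<le> 0 \<longleftrightarrow> x \<in> {cat_x_minus \<alpha> c\<^sub>1 c\<^sub>2 p..cat_x_plus \<alpha> c\<^sub>1 c\<^sub>2 p}"
    and "cat_B \<alpha> c\<^sub>1 c\<^sub>2 x p = 0 \<longleftrightarrow> x \<in> {cat_x_minus \<alpha> c\<^sub>1 c\<^sub>2 p, cat_x_plus \<alpha> c\<^sub>1 c\<^sub>2 p}"
proof -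
  let ?w = "cat_ratio \<alpha> c\<^sub>1 c\<^sub>2" and ?m = "cat_x_minus \<alpha> c\<^sub>1 c\<^sub>2 p" and ?q = "cat_x_plus \<alpha> c\<^sub>1 c\<^sub>2 p"
  note le = cat_ratio_le_iff[OF assms(1-3)]
  have eq: "?w x = ?w y \<longleftrightarrow> x = y" for y
    unfolding order_eq_iff le by auto
  have pos: "0 < (cmod c\<^sub>2)\<^sup>2 * exp (- (x + disp \<alpha>)\<^sup>2)"
    using assms by simp
  show "cat_B \<alpha> c\<^sub>1 c\<^sub>2 x p = 0 \<longleftrightarrow> x \<in> {?m, ?q}"
    unfolding cat_B_factorization(2)[OF assms] using assms(2) by (simp add: eq)
  have "cat_B \<alpha> c\<^sub>1 c\<^sub>2 x p \<le> 0 \<longleftrightarrow> (?w x - ?w ?m) * (?w x - ?w ?q) \<le> 0"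
    unfolding cat_B_factorization(2)[OF assms] using pos by (simp only: mult_le_0_iff) auto
  also have "\<dots> \<longleftrightarrow> x \<in> {?m..?q}"
    unfolding mult_le_0_iff diff_le_0_iff_le diff_ge_0_iff_ge le
    using cat_B_factorization(1)[OF assms] by auto
  finally show "cat_B \<alpha> c\<^sub>1 c\<^sub>2 x p \<le> 0 \<longleftrightarrow> x \<in> {?m..?q}" .
qed

text \<open>A single zero excludes both situations in which \<open>cat_B\<close> is positive: zero
  displacement, and \<open>cat_xi\<close> above the threshold.\<close>

lemma cat_B_zeros:
  assumes "cat_norm \<alpha> c\<^sub>1 c\<^sub>2 \<noteq> 0" "c\<^sub>1 \<noteq> 0" "c\<^sub>2 \<noteq> 0" and zero: "cat_B \<alpha> c\<^sub>1 c\<^sub>2 x p = 0"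
  shows "{x. cat_B \<alpha> c\<^sub>1 c\<^sub>2 x p = 0} = {cat_x_minus \<alpha> c\<^sub>1 c\<^sub>2 p, cat_x_plus \<alpha> c\<^sub>1 c\<^sub>2 p}"
proof -
  have "\<alpha> \<noteq> 0"
    using cat_B_zero_displacement_pos[of c\<^sub>1 c\<^sub>2 x p] assms(1) zero by auto
  moreover have "cat_xi \<alpha> c\<^sub>1 c\<^sub>2 p \<le> - exp (- (disp \<alpha>)\<^sup>2)"
    using cat_B_pos[OF assms(2,3), of \<alpha> p x] zero by fastforce
  ultimately show ?thesis
    using cat_B_sign(2)[OF assms(2,3)] by blast
qed

section \<open>The integral of the absolute value of \<open>cat_B\<close>\<close>

lemma has_bochner_integral_abs_cat_B:
  assumes "cat_norm \<alpha> c\<^sub>1 c\<^sub>2 \<noteq> 0" "c\<^sub>1 \<noteq> 0" "c\<^sub>2 \<noteq> 0"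
  shows "has_bochner_integral lborel (\<lambda>x. \<bar>cat_B \<alpha> c\<^sub>1 c\<^sub>2 x p\<bar>)
    (if cat_xi \<alpha> c\<^sub>1 c\<^sub>2 p > - exp (- (disp \<alpha>)\<^sup>2)
     then sqrt pi * ((cmod c\<^sub>1)\<^sup>2 + (cmod c\<^sub>2)\<^sup>2 + 2 * cmod (c\<^sub>1 * c\<^sub>2) * cat_xi \<alpha> c\<^sub>1 c\<^sub>2 p)
     else sqrt pi * ((cmod c\<^sub>1)\<^sup>2 + (cmod c\<^sub>2)\<^sup>2 + 2 * cmod (c\<^sub>1 * c\<^sub>2) * cat_xi \<alpha> c\<^sub>1 c\<^sub>2 p)
          - 2 * cat_J \<alpha> c\<^sub>1 c\<^sub>2 p)"
    (is "has_bochner_integral _ ?f (if ?gt then ?I else ?I - 2 * ?J)")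
proof -
  have pos: "has_bochner_integral lborel ?f ?I" if "\<And>x. cat_B \<alpha> c\<^sub>1 c\<^sub>2 x p > 0"
    using has_bochner_integral_cat_B[of \<alpha> c\<^sub>1 c\<^sub>2 p] abs_of_pos[OF that] by simp
  consider "?gt" | "\<not> ?gt" "\<alpha> = 0" | "\<not> ?gt" "\<alpha> \<noteq> 0"
    by blast
  then show ?thesis
  proof cases
    case 1
    then show ?thesis
      using pos[OF cat_B_pos[OF assms(2,3) 1]] by simp
  next
    \<comment> \<open>Here the prefactor \<open>1 / (2 * disp \<alpha>)\<close> is
      \<open>1 / 0 = 0\<close>, so both roots default to 0 and \<open>cat_J\<close> vanishes, in
      agreement with the positivity of \<open>cat_B\<close>.\<close>
    case 2
    then have "?J = 0"
      by (simp add: cat_J_def cat_x_minus_def cat_x_plus_def cat_root_def disp_def)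
    moreover have "has_bochner_integral lborel ?f ?I"
      using pos cat_B_zero_displacement_pos assms(1) 2(2) by blast
    ultimately show ?thesis
      using 2(1) by simp
  next
    case 3
    then have le: "cat_xi \<alpha> c\<^sub>1 c\<^sub>2 p \<le> - exp (- (disp \<alpha>)\<^sup>2)"
      by simp
    let ?S = "{cat_x_minus \<alpha> c\<^sub>1 c\<^sub>2 p..cat_x_plus \<alpha> c\<^sub>1 c\<^sub>2 p}"
    note ordered = cat_B_factorization(1)[OF assms(2,3) 3(2) le]
    have "has_bochner_integral lborel (\<lambda>x. cat_B \<alpha> c\<^sub>1 c\<^sub>2 x p - 2 * (cat_B \<alpha> c\<^sub>1 c\<^sub>2 x p * indicator ?S x)) (?I - 2 * ?J)"
      by (intro has_bochner_integral_diff has_bochner_integral_mult_right has_bochner_integral_cat_B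
          has_bochner_integral_cat_B_roots ordered)
    moreover have "cat_B \<alpha> c\<^sub>1 c\<^sub>2 x p - 2 * (cat_B \<alpha> c\<^sub>1 c\<^sub>2 x p * indicator ?S x) = ?f x" for x
      using cat_B_sign(1)[OF assms(2,3) 3(2) le, of x] by (cases "x \<in> ?S") auto
    ultimately show ?thesis
      using 3(1) by simp
  qed
qed

section \<open>Superpositions that reduce to a coherent state\<close>

text \<open>Without the interference term \<open>cat_B\<close> is nonnegative. The inner and outer
  integrals contribute \<open>sqrt pi\<close> each, and the quadrature formula gives 1/2 -
  1/2.\<close>

lemma wigner_negativity_coherent:
  assumes "cat_norm \<alpha> c\<^sub>1 c\<^sub>2 \<noteq> 0" "c\<^sub>1 = 0 \<or> c\<^sub>2 = 0"
  shows "wigner_negativity (cat_state \<alpha> c\<^sub>1 c\<^sub>2) = 0"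
proof -
  have \<Lambda>: "(cmod c\<^sub>1)\<^sup>2 + (cmod c\<^sub>2)\<^sup>2 = cat_norm \<alpha> c\<^sub>1 c\<^sub>2"
    using assms(2) by (auto simp: cat_norm_def)
  have nonneg: "\<bar>cat_B \<alpha> c\<^sub>1 c\<^sub>2 x p\<bar> = cat_B \<alpha> c\<^sub>1 c\<^sub>2 x p" for x p
    using assms(2) by (auto simp: cat_B_def)
  have "(LINT x|lborel. cat_B \<alpha> c\<^sub>1 c\<^sub>2 x p) = sqrt pi * cat_norm \<alpha> c\<^sub>1 c\<^sub>2" for p
    using has_bochner_integral_integral_eq[OF has_bochner_integral_cat_B[of \<alpha> c\<^sub>1 c\<^sub>2 p]] assms(2) \<Lambda> by auto
  moreover have "(LINT p|lborel. exp (- p\<^sup>2)) = sqrt pi"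
    using has_bochner_integral_integral_eq[OF has_bochner_integral_gaussian[of 0]] by simp
  ultimately show ?thesis
    unfolding wigner_negativity_cat_state(2) nonneg using assms(1) by simp
qed

text \<open>A nonzero norm forces the remaining coefficient, and with it the scalar
  \<open>k\<close>, to be nonzero.\<close>

lemma cat_state_eq_coherent:
  assumes "cat_norm \<alpha> c\<^sub>1 c\<^sub>2 \<noteq> 0" "c\<^sub>1 = 0 \<or> c\<^sub>2 = 0"
  shows "\<exists>\<beta>\<in>{\<alpha>, - \<alpha>}. \<exists>k. k \<noteq> 0 \<and> cat_state \<alpha> c\<^sub>1 c\<^sub>2 = (\<lambda>x. k * coherent \<beta> x)"
proof (cases "c\<^sub>1 = 0")
  case True
  then have "c\<^sub>2 \<noteq> 0"
    using assms(1) by (auto simp: cat_norm_def)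
  then show ?thesis
    using assms(1) True
    by (intro bexI[of _ "- \<alpha>"] exI[of _ "c\<^sub>2 / of_real (sqrt (cat_norm \<alpha> c\<^sub>1 c\<^sub>2))"])
       (auto simp: cat_state_def)
next
  case False
  with assms show ?thesis
    by (intro bexI[of _ \<alpha>] exI[of _ "c\<^sub>1 / of_real (sqrt (cat_norm \<alpha> c\<^sub>1 c\<^sub>2))"])
       (auto simp: cat_state_def)
qed

text \<open>Integrals of non-integrable functions default to 0. The conclusion therefore also
  asserts integrability of the Wigner function on the plane and of the integrand in
  \<open>p\<close>, and states the integral over \<open>x\<close> by
  \<open>has_bochner_integral\<close>.\<close>

theorem proposition5:
  fixes \<alpha> :: real and c\<^sub>1 c\<^sub>2 :: complex
  assumes "cat_norm \<alpha> c\<^sub>1 c\<^sub>2 \<noteq> 0"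
  shows
    "has_bochner_integral lborel (\<lambda>x. (cmod (cat_state \<alpha> c\<^sub>1 c\<^sub>2 x))\<^sup>2) 1
     \<and> (\<forall>x p. wigner (cat_state \<alpha> c\<^sub>1 c\<^sub>2) x p =
          of_real (1 / (pi * cat_norm \<alpha> c\<^sub>1 c\<^sub>2) *
            ((cmod c\<^sub>1)\<^sup>2 * exp (- (x - disp \<alpha>)\<^sup>2 - p\<^sup>2)
             + (cmod c\<^sub>2)\<^sup>2 * exp (- (x + disp \<alpha>)\<^sup>2 - p\<^sup>2)
             + 2 * cmod (c\<^sub>1 * c\<^sub>2) * exp (- x\<^sup>2 - p\<^sup>2) * cos (2 * disp \<alpha> * p - cat_phase c\<^sub>1 c\<^sub>2))))
     \<and> integrable (lborel :: (real \<times> real) measure)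
          (\<lambda>z. wigner (cat_state \<alpha> c\<^sub>1 c\<^sub>2) (fst z) (snd z))
     \<and> (c\<^sub>1 \<noteq> 0 \<and> c\<^sub>2 \<noteq> 0 \<longrightarrow>
          (\<forall>x p. wigner (cat_state \<alpha> c\<^sub>1 c\<^sub>2) x p =
             of_real (exp (- p\<^sup>2) * cat_B \<alpha> c\<^sub>1 c\<^sub>2 x p / (pi * cat_norm \<alpha> c\<^sub>1 c\<^sub>2)))
          \<and> (\<forall>p. (\<exists>x. cat_B \<alpha> c\<^sub>1 c\<^sub>2 x p = 0) \<longrightarrow>
               {x. cat_B \<alpha> c\<^sub>1 c\<^sub>2 x p = 0} = {cat_x_minus \<alpha> c\<^sub>1 c\<^sub>2 p, cat_x_plus \<alpha> c\<^sub>1 c\<^sub>2 p})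
          \<and> (\<forall>p. has_bochner_integral lborel (\<lambda>x. \<bar>cat_B \<alpha> c\<^sub>1 c\<^sub>2 x p\<bar>)
               (if cat_xi \<alpha> c\<^sub>1 c\<^sub>2 p > - exp (- (disp \<alpha>)\<^sup>2)
                then sqrt pi * ((cmod c\<^sub>1)\<^sup>2 + (cmod c\<^sub>2)\<^sup>2 + 2 * cmod (c\<^sub>1 * c\<^sub>2) * cat_xi \<alpha> c\<^sub>1 c\<^sub>2 p)
                else sqrt pi * ((cmod c\<^sub>1)\<^sup>2 + (cmod c\<^sub>2)\<^sup>2 + 2 * cmod (c\<^sub>1 * c\<^sub>2) * cat_xi \<alpha> c\<^sub>1 c\<^sub>2 p)
                     - 2 * cat_J \<alpha> c\<^sub>1 c\<^sub>2 p))
          \<and> integrable lborel (\<lambda>p. exp (- p\<^sup>2) * (LINT x|lborel. \<bar>cat_B \<alpha> c\<^sub>1 c\<^sub>2 x p\<bar>))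
          \<and> wigner_negativity (cat_state \<alpha> c\<^sub>1 c\<^sub>2) =
               1 / (2 * pi * cat_norm \<alpha> c\<^sub>1 c\<^sub>2) *
                 (LINT p|lborel. exp (- p\<^sup>2) * (LINT x|lborel. \<bar>cat_B \<alpha> c\<^sub>1 c\<^sub>2 x p\<bar>)) - 1 / 2)
     \<and> (c\<^sub>1 = 0 \<or> c\<^sub>2 = 0 \<longrightarrow>
          (\<exists>\<beta>\<in>{\<alpha>, - \<alpha>}. \<exists>k. k \<noteq> 0 \<and> cat_state \<alpha> c\<^sub>1 c\<^sub>2 = (\<lambda>x. k * coherent \<beta> x))
          \<and> wigner_negativity (cat_state \<alpha> c\<^sub>1 c\<^sub>2) = 0)"
proof -
  let ?\<Lambda> = "cat_norm \<alpha> c\<^sub>1 c\<^sub>2"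
  have "exp (- p\<^sup>2) * cat_B \<alpha> c\<^sub>1 c\<^sub>2 x p =
      (cmod c\<^sub>1)\<^sup>2 * exp (- (x - disp \<alpha>)\<^sup>2 - p\<^sup>2)
      + (cmod c\<^sub>2)\<^sup>2 * exp (- (x + disp \<alpha>)\<^sup>2 - p\<^sup>2)
      + 2 * cmod (c\<^sub>1 * c\<^sub>2) * exp (- x\<^sup>2 - p\<^sup>2) * cos (2 * disp \<alpha> * p - cat_phase c\<^sub>1 c\<^sub>2)" for x p
    unfolding cat_B_def cat_xi_def diff_conv_add_uminus[of _ "p\<^sup>2"] exp_add by (simp only: algebra_simps)
  then have "wigner (cat_state \<alpha> c\<^sub>1 c\<^sub>2) x p =
      of_real (1 / (pi * ?\<Lambda>) *
        ((cmod c\<^sub>1)\<^sup>2 * exp (- (x - disp \<alpha>)\<^sup>2 - p\<^sup>2)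
         + (cmod c\<^sub>2)\<^sup>2 * exp (- (x + disp \<alpha>)\<^sup>2 - p\<^sup>2)
         + 2 * cmod (c\<^sub>1 * c\<^sub>2) * exp (- x\<^sup>2 - p\<^sup>2) * cos (2 * disp \<alpha> * p - cat_phase c\<^sub>1 c\<^sub>2)))" for x p
    by (simp only: wigner_cat_state times_divide_eq_left mult_1)
  moreover have "integrable (lborel :: (real \<times> real) measure) (\<lambda>z. wigner (cat_state \<alpha> c\<^sub>1 c\<^sub>2) (fst z) (snd z))"
    unfolding wigner_cat_state by (intro integrable_of_real integrable_divide_zero integrable_cat_B_prod)
  ultimately show ?thesis
    using has_bochner_integral_cat_state[OF assms] wigner_cat_state[of \<alpha> c\<^sub>1 c\<^sub>2]
      cat_B_zeros[OF assms] has_bochner_integral_abs_cat_B[OF assms] wigner_negativity_cat_state[of \<alpha> c\<^sub>1 c\<^sub>2]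
      cat_state_eq_coherent[OF assms] wigner_negativity_coherent[OF assms]
    by (intro conjI impI allI) blast+
qed

end
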